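(* (a) If $f\in L^2(\mathbb{T})$ then $\sum_{n\in\mathbb{Z}}\hat f(n)e^{int}=f$ with unconditional convergence in $L^2(\mathbb{T})$. That is, $(\hat f)\check{\ }=f$. (b) If $c=\{c_n\}_{n\in\mathbb{Z}}\in\ell^2(\mathbb{Z})$ then for every $j\in\mathbb{Z}$ the $j$-th Fourier coefficient of $\sum_{n\in\mathbb{Z}}c_ne^{int}$ equals $c_j$. That is, $(\check c)\hat{\ }=c$. (c) $\{e^{int}\}_{n\in\mathbb{Z}}$ is an orthonormal basis of $L^2(\mathbb{T})$.
   Context: $\mathbb{T}=\mathbb{R}/2\pi\mathbb{Z}$, and $L^2(\mathbb{T})$ is the space of complex-valued $2\pi$-periodic square integrable functions with inner product $\langle f,g\rangle=\frac{1}{2\pi}\int_{\mathbb{T}}f(t)\overline{g(t)}\,dt$. Fourier coefficients: $\hat f(n)=\frac{1}{2\pi}\int_{\mathbb{T}}f(t)e^{-int}\,dt$; Fourier analysis is the map $f\mapsto\hat f=\{\hat f(n)\}_{n\in\mathbb{Z}}$ from $L^2(\mathbb{T})$ to $\ell^2(\mathbb{Z})$. Fourier synthesis is the map $c=\{c_n\}\mapsto\check c=\sum_nc_ne^{int}$ from $\ell^2(\mathbb{Z})$ to $L^2(\mathbb{T})$, the series converging in $L^2(\mathbb{T})$. *)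

theory Defs
  imports "HOL-Analysis.Analysis"
begin

text \<open>
  Elements of \<open>L\<^sup>2(\<T>)\<close> are represented by functions, not by equivalence classes; equality in
  \<open>L\<^sup>2(\<T>)\<close> is therefore equality almost everywhere. Since all functions are \<open>2\<pi>\<close>-periodic, integrals
  over \<open>\<T>\<close> are taken over the period \<open>[0, 2\<pi>]\<close>.
\<close>

definition L2T :: "(real \<Rightarrow> complex) set" where
  "L2T = {f. f \<in> borel_measurable lebesgue \<and> (\<forall>t. f (t + 2 * pi) = f t) \<and>
             integrable (lebesgue_on {0..2 * pi}) (\<lambda>t. (cmod (f t))\<^sup>2)}"

definition L2T_inner :: "(real \<Rightarrow> complex) \<Rightarrow> (real \<Rightarrow> complex) \<Rightarrow> complex" where
  "L2T_inner f g =
     complex_of_real (1 / (2 * pi)) * (LINT t|lebesgue_on {0..2 * pi}. f t * cnj (g t))"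

definition L2T_norm :: "(real \<Rightarrow> complex) \<Rightarrow> real" where
  "L2T_norm f = sqrt (Re (L2T_inner f f))"

text \<open>
  Unconditional convergence in \<open>L\<^sup>2(\<T>)\<close>: the net of all finite partial sums converges in norm. This
  is the mode of convergence of \<^const>\<open>has_sum\<close>, which does not apply directly because
  \<^const>\<open>L2T_norm\<close> is only a seminorm on functions. Membership in \<^const>\<open>L2T\<close> is demanded
  because the integral of a non-integrable function is 0 by convention.
\<close>

definition L2T_has_sum :: "('i \<Rightarrow> real \<Rightarrow> complex) \<Rightarrow> (real \<Rightarrow> complex) \<Rightarrow> bool" where
  "L2T_has_sum u f \<longleftrightarrow> (\<forall>n. u n \<in> L2T) \<and> f \<in> L2T \<and>
     ((\<lambda>F. L2T_norm (\<lambda>t. (\<Sum>n\<in>F. u n t) - f t)) \<longlongrightarrow> 0) (finite_subsets_at_top UNIV)"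

text \<open>Orthonormal basis of \<open>L\<^sup>2(\<T>)\<close>: an orthonormal family whose linear span is dense.\<close>

definition L2T_orthonormal_basis :: "('i \<Rightarrow> real \<Rightarrow> complex) \<Rightarrow> bool" where
  "L2T_orthonormal_basis u \<longleftrightarrow> (\<forall>n. u n \<in> L2T) \<and>
     (\<forall>m n. L2T_inner (u m) (u n) = (if m = n then 1 else 0)) \<and>
     (\<forall>f\<in>L2T. \<forall>\<epsilon>>0. \<exists>F a. finite F \<and> L2T_norm (\<lambda>t. f t - (\<Sum>n\<in>F. a n * u n t)) < \<epsilon>)"

definition l2Z :: "(int \<Rightarrow> complex) set" where
  "l2Z = {c. (\<lambda>n. (cmod (c n))\<^sup>2) summable_on UNIV}"

definition fourier_exp :: "int \<Rightarrow> real \<Rightarrow> complex" where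
  "fourier_exp n t = exp (\<i> * of_int n * of_real t)"

definition fourier_coeff :: "(real \<Rightarrow> complex) \<Rightarrow> int \<Rightarrow> complex" where
  "fourier_coeff f n = complex_of_real (1 / (2 * pi)) *
     (LINT t|lebesgue_on {0..2 * pi}. f t * exp (- (\<i> * of_int n * of_real t)))"

text \<open>The sum is determined only up to equality almost everywhere, so a representative is chosen.\<close>

definition fourier_synthesis :: "(int \<Rightarrow> complex) \<Rightarrow> real \<Rightarrow> complex" where
  "fourier_synthesis c = (SOME g. L2T_has_sum (\<lambda>n t. c n * fourier_exp n t) g)"

end

theory Submission
  imports Defs
begin

text \<open>
  The theorem combines two facts. The first is uniqueness: a function in \<open>L\<^sup>2(\<T>)\<close> all of whose Fourier
  coefficients vanish is zero almost everywhere (\<open>AE_eq_0_of_fourier_coeff_eq_0\<close>). The second is the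
  Riesz-Fischer theorem: for square summable \<open>c\<close> the series \<open>\<Sum>c\<^sub>n e\<^sup>i\<^sup>n\<^sup>t\<close> converges
  unconditionally to some function in \<open>L\<^sup>2(\<T>)\<close> (\<open>riesz_fischer\<close>), whose coefficients are \<open>c\<close> because
  each coefficient is continuous in the norm (\<open>fourier_coeff_of_has_sum\<close>). Given \<open>f\<close>, Bessel's
  inequality makes its coefficients square summable, so its Fourier series has a sum \<open>g\<close> with the same
  coefficients as \<open>f\<close>, and uniqueness gives \<open>g = f\<close> almost everywhere. The density of
  the trigonometric polynomials in \<open>L\<^sup>2(\<T>)\<close>, and with it the basis property, follows.

  For uniqueness, a function with vanishing coefficients is orthogonal to all trigonometric
  polynomials, hence by Stone-Weierstrass on the unit circle to all continuous functions of \<open>e\<^sup>i\<^sup>t\<close>,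
  hence by dominated convergence to the indicators of compact sets. By inner regularity the sets where
  the real or imaginary part has a strict sign are then null.

  For Riesz-Fischer, the square of the norm of a trigonometric polynomial is the sum of the squares of
  its coefficients, so suitable partial sums have increments with geometrically decreasing norms. They
  converge almost everywhere, and Fatou's lemma turns this into norm convergence.
\<close>

section \<open>The seminormed space and its inner product\<close>

abbreviation circle_measure :: "real measure" where
  "circle_measure \<equiv> lebesgue_on {0..2 * pi}"

definition trig_poly :: "int set \<Rightarrow> (int \<Rightarrow> complex) \<Rightarrow> real \<Rightarrow> complex" where
  "trig_poly F a t = (\<Sum>n\<in>F. a n * fourier_exp n t)"

lemma finite_circle_measure: "finite_measure circle_measure"
  by (rule finite_measureI) (simp add: emeasure_restrict_space space_restrict_space)

lemma L2T_measurable: "f \<in> L2T \<Longrightarrow> f \<in> borel_measurable circle_measure"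
  by (auto simp: L2T_def intro: measurable_restrict_space1)

lemma L2T_square_integrable: "f \<in> L2T \<Longrightarrow> integrable circle_measure (\<lambda>t. (cmod (f t))\<^sup>2)"
  by (simp add: L2T_def)

lemma L2T_periodic: "f \<in> L2T \<Longrightarrow> f (t + 2 * pi) = f t"
  by (simp add: L2T_def)

lemma norm_mult_le_sum_squares: "cmod (z * w) \<le> (cmod z)\<^sup>2 + (cmod w)\<^sup>2"
proof -
  have "2 * (cmod z * cmod w) \<le> (cmod z)\<^sup>2 + (cmod w)\<^sup>2"
    using zero_le_power2[of "cmod z - cmod w"] by (simp add: power2_diff)
  moreover have "0 \<le> cmod z * cmod w" by simp
  ultimately show ?thesis unfolding norm_mult by linarith
qed

lemma borel_measurable_cnj:
  "f \<in> borel_measurable M \<Longrightarrow> (\<lambda>x. cnj (f x)) \<in> borel_measurable M"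
  by (rule borel_measurable_continuous_on) (auto intro: continuous_intros)

lemma integrable_mult_cnj:
  assumes "f \<in> L2T" "g \<in> L2T"
  shows "integrable circle_measure (\<lambda>t. f t * cnj (g t))"
proof (rule Bochner_Integration.integrable_bound)
  show "integrable circle_measure (\<lambda>t. (cmod (f t))\<^sup>2 + (cmod (g t))\<^sup>2)"
    using assms by (simp add: L2T_square_integrable)
  show "(\<lambda>t. f t * cnj (g t)) \<in> borel_measurable circle_measure"
    using assms[THEN L2T_measurable]
    by (intro borel_measurable_times borel_measurable_cnj)
  show "AE t in circle_measure. norm (f t * cnj (g t)) \<le> norm ((cmod (f t))\<^sup>2 + (cmod (g t))\<^sup>2)"
    using norm_mult_le_sum_squares[of _ "cnj _"] by auto
qed

lemma fourier_exp_in_L2T: "fourier_exp n \<in> L2T"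
proof -
  have "continuous_on UNIV (fourier_exp n)"
    unfolding fourier_exp_def by (intro continuous_intros)
  then have "fourier_exp n \<in> borel_measurable lebesgue"
    by (intro measurable_completion) (simp add: borel_measurable_continuous_onI)
  moreover have "fourier_exp n (t + 2 * pi) = fourier_exp n t" for t
    unfolding fourier_exp_def by (rule exp_eq[THEN iffD2]) (auto intro!: exI[of _ n] simp: algebra_simps)
  moreover have "integrable circle_measure (\<lambda>t. (cmod (fourier_exp n t))\<^sup>2)"
    using finite_measure.integrable_const[OF finite_circle_measure, of "1::real"]
    by (simp add: fourier_exp_def)
  ultimately show ?thesis
    by (simp add: L2T_def)
qed

lemma L2T_zero: "(\<lambda>t. 0) \<in> L2T"
  by (simp add: L2T_def)

lemma L2T_cmult:
  assumes "f \<in> L2T" shows "(\<lambda>t. c * f t) \<in> L2T"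
  using assms by (auto simp: L2T_def norm_mult power_mult_distrib)

lemma L2T_add:
  assumes "f \<in> L2T" "g \<in> L2T" shows "(\<lambda>t. f t + g t) \<in> L2T"
proof -
  have "integrable circle_measure (\<lambda>t. (cmod (f t + g t))\<^sup>2)"
  proof (rule Bochner_Integration.integrable_bound)
    show "integrable circle_measure (\<lambda>t. 2 * (cmod (f t))\<^sup>2 + 2 * (cmod (g t))\<^sup>2)"
      using assms by (simp add: L2T_square_integrable)
    show "(\<lambda>t. (cmod (f t + g t))\<^sup>2) \<in> borel_measurable circle_measure"
      using assms[THEN L2T_measurable] by measurable
    have "(cmod (z + w))\<^sup>2 \<le> 2 * (cmod z)\<^sup>2 + 2 * (cmod w)\<^sup>2" for z w
    proof -
      have "(cmod (z + w))\<^sup>2 \<le> (cmod z + cmod w)\<^sup>2"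
        by (intro power_mono norm_triangle_ineq) simp
      also have "\<dots> \<le> 2 * (cmod z)\<^sup>2 + 2 * (cmod w)\<^sup>2"
        using zero_le_power2[of "cmod z - cmod w"] by (simp add: power2_diff power2_sum)
      finally show ?thesis .
    qed
    then show "AE t in circle_measure. norm ((cmod (f t + g t))\<^sup>2)
        \<le> norm (2 * (cmod (f t))\<^sup>2 + 2 * (cmod (g t))\<^sup>2)"
      by auto
  qed
  then show ?thesis
    using assms by (auto simp: L2T_def)
qed

lemma L2T_diff:
  assumes "f \<in> L2T" "g \<in> L2T" shows "(\<lambda>t. f t - g t) \<in> L2T"
  using L2T_add[OF assms(1) L2T_cmult[OF assms(2), of "-1"]] by simp

lemma trig_poly_in_L2T: "trig_poly F a \<in> L2T"
proof (induction F rule: infinite_finite_induct)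
  case (insert n F)
  then show ?case
    using L2T_add[OF L2T_cmult[OF fourier_exp_in_L2T, of "a n" n] insert.IH]
    by (simp add: trig_poly_def[abs_def])
qed (simp_all add: trig_poly_def[abs_def] L2T_zero)

lemma integrable_L2T: "f \<in> L2T \<Longrightarrow> integrable circle_measure f"
  using integrable_mult_cnj[OF _ fourier_exp_in_L2T[of 0]] by (simp add: fourier_exp_def)

lemma L2T_inner_diff_left:
  assumes "f \<in> L2T" "g \<in> L2T" "h \<in> L2T"
  shows "L2T_inner (\<lambda>t. f t - g t) h = L2T_inner f h - L2T_inner g h"
  using assms by (simp add: L2T_inner_def left_diff_distrib integrable_mult_cnj right_diff_distrib)

lemma L2T_inner_cnj: "L2T_inner g f = cnj (L2T_inner f g)"
proof -
  have "(LINT t|circle_measure. g t * cnj (f t)) = cnj (LINT t|circle_measure. f t * cnj (g t))"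
    by (subst Bochner_Integration.integral_cnj[symmetric]) (simp add: mult.commute)
  then show ?thesis
    by (simp add: L2T_inner_def)
qed

lemma L2T_inner_trig_poly_left:
  assumes "f \<in> L2T"
  shows "L2T_inner (trig_poly F a) f = (\<Sum>n\<in>F. a n * L2T_inner (fourier_exp n) f)"
proof -
  have "(LINT t|circle_measure. trig_poly F a t * cnj (f t))
      = (LINT t|circle_measure. (\<Sum>n\<in>F. a n * (fourier_exp n t * cnj (f t))))"
    by (simp add: trig_poly_def sum_distrib_right mult.assoc)
  also have "\<dots> = (\<Sum>n\<in>F. a n * (LINT t|circle_measure. fourier_exp n t * cnj (f t)))"
    using assms by (subst Bochner_Integration.integral_sum)
      (auto intro!: integrable_mult_right integrable_mult_cnj fourier_exp_in_L2T)
  finally show ?thesis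
    by (simp add: L2T_inner_def sum_distrib_left mult_ac)
qed

section \<open>Orthonormality and Bessel's inequality\<close>

lemma fourier_coeff_eq_inner: "fourier_coeff f n = L2T_inner f (fourier_exp n)"
  by (simp add: fourier_coeff_def L2T_inner_def fourier_exp_def exp_cnj)

text \<open>
  The product of one exponential with the conjugate of another is again an exponential, whose
  antiderivative is periodic unless the frequencies agree.
\<close>

lemma fourier_exp_orthonormal:
  "L2T_inner (fourier_exp m) (fourier_exp n) = (if m = n then 1 else 0)"
proof -
  have "fourier_exp m t * cnj (fourier_exp n t) = fourier_exp (m - n) t" for t
    by (simp add: fourier_exp_def exp_cnj algebra_simps exp_diff exp_minus field_simps)
  then have eq: "L2T_inner (fourier_exp m) (fourier_exp n)
      = complex_of_real (1 / (2 * pi)) * (LINT t|circle_measure. fourier_exp (m - n) t)"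
    by (simp add: L2T_inner_def)
  have LH: "(LINT t|circle_measure. fourier_exp k t) = integral {0..2 * pi} (fourier_exp k)" for k
    by (rule lebesgue_integral_eq_integral) (simp_all add: integrable_L2T fourier_exp_in_L2T)
  show ?thesis
  proof (cases "m = n")
    case True
    have "integral {0..2 * pi} (fourier_exp 0) = 2 * pi"
      by (simp add: fourier_exp_def[abs_def] scaleR_conv_of_real)
    then show ?thesis using True unfolding eq LH by simp
  next
    case False
    define k where "k = m - n"
    have k: "k \<noteq> 0" using False by (simp add: k_def)
    let ?G = "\<lambda>t. fourier_exp k t / (\<i> * of_int k)"
    have "(fourier_exp k has_integral (?G (2 * pi) - ?G 0)) {0..2 * pi}"
    proof (rule fundamental_theorem_of_calculus)
      show "(?G has_vector_derivative fourier_exp k x) (at x within {0..2 * pi})" for x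
        unfolding fourier_exp_def using k
        by (auto intro!: derivative_eq_intros has_vector_derivative_real_field simp: field_simps)
    qed simp
    moreover have "?G (2 * pi) = ?G 0"
      using L2T_periodic[OF fourier_exp_in_L2T, of k 0] by simp
    ultimately show ?thesis
      using False integral_unique unfolding eq LH k_def by force
  qed
qed

lemma fourier_coeff_trig_poly:
  assumes "finite F"
  shows "fourier_coeff (trig_poly F a) j = (if j \<in> F then a j else 0)"
  using assms by (simp add: fourier_coeff_eq_inner L2T_inner_trig_poly_left fourier_exp_in_L2T
      fourier_exp_orthonormal if_distrib[of "\<lambda>x. _ * x"] cong: if_cong)

lemma L2T_inner_self:
  "L2T_inner f f = complex_of_real (1 / (2 * pi) * (LINT t|circle_measure. (cmod (f t))\<^sup>2))"
  by (simp add: L2T_inner_def flip: complex_norm_square of_real_power)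

lemma L2T_norm_square:
  "(L2T_norm f)\<^sup>2 = 1 / (2 * pi) * (LINT t|circle_measure. (cmod (f t))\<^sup>2)"
  by (simp add: L2T_norm_def L2T_inner_self)

lemma L2T_norm_nonneg: "0 \<le> L2T_norm f"
  by (simp add: L2T_norm_def L2T_inner_self)

lemma L2T_norm_minus_commute: "L2T_norm (\<lambda>t. f t - g t) = L2T_norm (\<lambda>t. g t - f t)"
  by (simp add: L2T_norm_def L2T_inner_self norm_minus_commute)

lemma L2T_norm_cong_AE:
  assumes "AE t in circle_measure. f t = g t" "f \<in> L2T" "g \<in> L2T"
  shows "L2T_norm f = L2T_norm g"
proof -
  have "(LINT t|circle_measure. (cmod (f t))\<^sup>2) = (LINT t|circle_measure. (cmod (g t))\<^sup>2)"
    using assms(1) assms(2,3)[THEN L2T_measurable] by (intro integral_cong_AE) auto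
  then show ?thesis by (simp add: L2T_norm_def L2T_inner_self)
qed

lemma L2T_norm_trig_poly:
  assumes "finite F"
  shows "(L2T_norm (trig_poly F a))\<^sup>2 = (\<Sum>n\<in>F. (cmod (a n))\<^sup>2)"
proof -
  have "L2T_inner (trig_poly F a) (trig_poly F a)
      = (\<Sum>n\<in>F. a n * cnj (fourier_coeff (trig_poly F a) n))"
    by (simp add: L2T_inner_trig_poly_left trig_poly_in_L2T fourier_coeff_eq_inner
        flip: L2T_inner_cnj)
  also have "\<dots> = complex_of_real (\<Sum>n\<in>F. (cmod (a n))\<^sup>2)"
    using assms by (simp add: fourier_coeff_trig_poly complex_norm_square del: of_real_power)
  finally show ?thesis
    by (simp add: L2T_norm_def sum_nonneg)
qed

text \<open>
  The partial Fourier sum \<open>p\<close> satisfies \<open>\<langle>p, f\<rangle> = \<langle>p, p\<rangle> = \<Sum>\<bar>f^(n)\<bar>\<^sup>2\<close>, so the mixed terms in the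
  expansion of \<open>\<langle>f - p, f - p\<rangle>\<close> collapse. Bessel's inequality drops the nonnegative left-hand side;
  with a single frequency it plays the part of the Cauchy-Schwarz inequality and makes each Fourier
  coefficient continuous in the norm.
\<close>

lemma bessel_identity:
  assumes f: "f \<in> L2T" and "finite F"
  shows "(L2T_norm (\<lambda>t. f t - trig_poly F (fourier_coeff f) t))\<^sup>2
       = (L2T_norm f)\<^sup>2 - (\<Sum>n\<in>F. (cmod (fourier_coeff f n))\<^sup>2)"
proof -
  let ?p = "trig_poly F (fourier_coeff f)" and ?S = "\<Sum>n\<in>F. (cmod (fourier_coeff f n))\<^sup>2"
  have p: "?p \<in> L2T" by (rule trig_poly_in_L2T)
  have d: "(\<lambda>t. f t - ?p t) \<in> L2T" by (rule L2T_diff[OF f p])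
  have pf: "L2T_inner ?p f = complex_of_real ?S"
    using f by (simp add: L2T_inner_trig_poly_left fourier_coeff_eq_inner complex_norm_square
        L2T_inner_cnj[of "fourier_exp _" f] del: of_real_power)
  have "L2T_inner ?p ?p = complex_of_real ((L2T_norm ?p)\<^sup>2)"
    by (simp add: L2T_norm_square L2T_inner_self)
  then have pp: "L2T_inner ?p ?p = complex_of_real ?S"
    using L2T_norm_trig_poly[OF \<open>finite F\<close>] by simp
  have "L2T_inner (\<lambda>t. f t - ?p t) (\<lambda>t. f t - ?p t)
      = cnj (L2T_inner (\<lambda>t. f t - ?p t) f) - cnj (L2T_inner (\<lambda>t. f t - ?p t) ?p)"
    using L2T_inner_diff_left[OF f p d] by (simp flip: L2T_inner_cnj)
  also have "\<dots> = L2T_inner f f - complex_of_real ?S"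
    using f p by (simp add: L2T_inner_diff_left pf pp L2T_inner_cnj[of f ?p])
      (simp add: L2T_inner_self)
  finally have "complex_of_real ((L2T_norm (\<lambda>t. f t - ?p t))\<^sup>2) = complex_of_real ((L2T_norm f)\<^sup>2 - ?S)"
    by (simp only: L2T_norm_square L2T_inner_self of_real_diff)
  then show ?thesis
    by (simp only: of_real_eq_iff)
qed

lemma bessel_inequality:
  assumes "f \<in> L2T" "finite F"
  shows "(\<Sum>n\<in>F. (cmod (fourier_coeff f n))\<^sup>2) \<le> (L2T_norm f)\<^sup>2"
  using bessel_identity[OF assms] by (metis diff_ge_0_iff_ge zero_le_power2)

lemma norm_fourier_coeff_le:
  assumes "f \<in> L2T" shows "cmod (fourier_coeff f j) \<le> L2T_norm f"
  using bessel_inequality[OF assms, of "{j}"] L2T_norm_nonneg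
  by (auto intro: power2_le_imp_le)

lemma fourier_coeff_in_l2Z:
  assumes "f \<in> L2T" shows "fourier_coeff f \<in> l2Z"
proof -
  have "(\<lambda>n. (cmod (fourier_coeff f n))\<^sup>2) summable_on UNIV"
    using bessel_inequality[OF assms]
    by (intro nonneg_bdd_above_summable_on) (auto simp: bdd_above_def)
  then show ?thesis by (simp add: l2Z_def)
qed

lemma fourier_coeff_diff:
  assumes "f \<in> L2T" "g \<in> L2T"
  shows "fourier_coeff (\<lambda>t. f t - g t) n = fourier_coeff f n - fourier_coeff g n"
  using assms by (simp add: fourier_coeff_eq_inner L2T_inner_diff_left fourier_exp_in_L2T)

lemma L2T_has_sum_iff:
  "L2T_has_sum (\<lambda>n t. c n * fourier_exp n t) g \<longleftrightarrow> g \<in> L2T \<and>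
     ((\<lambda>F. L2T_norm (\<lambda>t. trig_poly F c t - g t)) \<longlongrightarrow> 0) (finite_subsets_at_top UNIV)"
  by (simp add: L2T_has_sum_def trig_poly_def L2T_cmult fourier_exp_in_L2T)

text \<open>
  As soon as \<open>F\<close> contains \<open>j\<close>, the \<open>j\<close>-th coefficient of the partial sum is exactly \<open>c j\<close>; continuity of
  the coefficient then carries this to the limit.
\<close>

lemma fourier_coeff_of_has_sum:
  assumes "L2T_has_sum (\<lambda>n t. c n * fourier_exp n t) g"
  shows "fourier_coeff g j = c j"
proof -
  have g: "g \<in> L2T" and lim:
    "((\<lambda>F. L2T_norm (\<lambda>t. trig_poly F c t - g t)) \<longlongrightarrow> 0) (finite_subsets_at_top UNIV)"
    using assms by (auto simp: L2T_has_sum_iff)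
  have "\<forall>\<^sub>F F in finite_subsets_at_top UNIV.
      cmod (c j - fourier_coeff g j) \<le> L2T_norm (\<lambda>t. trig_poly F c t - g t)"
    unfolding eventually_finite_subsets_at_top
  proof (intro exI[of _ "{j}"] conjI allI impI)
    fix F assume F: "finite F \<and> {j} \<subseteq> F \<and> F \<subseteq> UNIV"
    have "fourier_coeff (\<lambda>t. trig_poly F c t - g t) j = c j - fourier_coeff g j"
      using F g by (simp add: fourier_coeff_diff trig_poly_in_L2T fourier_coeff_trig_poly)
    then show "cmod (c j - fourier_coeff g j) \<le> L2T_norm (\<lambda>t. trig_poly F c t - g t)"
      using norm_fourier_coeff_le[OF L2T_diff[OF trig_poly_in_L2T g], of F c j] by simp
  qed auto
  then have "cmod (c j - fourier_coeff g j) \<le> 0"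
    by (rule tendsto_lowerbound[OF lim]) simp
  then show ?thesis by simp
qed

section \<open>Trigonometric polynomials and continuous functions on the circle\<close>

lemma trig_poly_extend:
  assumes "finite G" "F \<subseteq> G"
  shows "trig_poly F a = trig_poly G (\<lambda>n. if n \<in> F then a n else 0)"
  unfolding trig_poly_def fun_eq_iff
  by (intro allI sum.mono_neutral_cong_left) (use assms in auto)

definition is_trig_poly :: "(real \<Rightarrow> complex) \<Rightarrow> bool" where
  "is_trig_poly p \<longleftrightarrow> (\<exists>F a. finite F \<and> p = trig_poly F a)"

lemma is_trig_poly_monomial: "is_trig_poly (\<lambda>t. c * fourier_exp n t)"
  unfolding is_trig_poly_def
  by (intro exI[of _ "{n}"] exI[of _ "\<lambda>_. c"]) (simp add: trig_poly_def fun_eq_iff)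

lemma is_trig_poly_add:
  assumes "is_trig_poly p" "is_trig_poly q" shows "is_trig_poly (\<lambda>t. p t + q t)"
proof -
  obtain F a G b where FG: "finite F" "finite G" and p: "p = trig_poly F a" and q: "q = trig_poly G b"
    using assms by (auto simp: is_trig_poly_def)
  have "p = trig_poly (F \<union> G) (\<lambda>n. if n \<in> F then a n else 0)"
    "q = trig_poly (F \<union> G) (\<lambda>n. if n \<in> G then b n else 0)"
    unfolding p q using FG by (auto intro!: trig_poly_extend)
  then have "(\<lambda>t. p t + q t) = trig_poly (F \<union> G)
      (\<lambda>n. (if n \<in> F then a n else 0) + (if n \<in> G then b n else 0))"
    by (simp add: trig_poly_def fun_eq_iff sum.distrib distrib_right)
  then show ?thesis
    unfolding is_trig_poly_def using FG by blast
qed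

lemma is_trig_poly_sum:
  assumes "\<And>i. i \<in> I \<Longrightarrow> is_trig_poly (p i)"
  shows "is_trig_poly (\<lambda>t. \<Sum>i\<in>I. p i t)"
  using assms
proof (induction I rule: infinite_finite_induct)
  case (insert i I)
  then show ?case by (simp add: is_trig_poly_add)
qed (use is_trig_poly_monomial[of 0] in simp_all)

lemma is_trig_poly_mult:
  assumes "is_trig_poly p" "is_trig_poly q" shows "is_trig_poly (\<lambda>t. p t * q t)"
proof -
  obtain F a G b where FG: "finite F" "finite G" and p: "p = trig_poly F a" and q: "q = trig_poly G b"
    using assms by (auto simp: is_trig_poly_def)
  have "(\<lambda>t. p t * q t) = (\<lambda>t. \<Sum>m\<in>F. \<Sum>n\<in>G. (a m * b n) * fourier_exp (m + n) t)"
    by (simp add: p q trig_poly_def sum_product fun_eq_iff fourier_exp_def distrib_left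
        distrib_right exp_add mult_ac)
  then show ?thesis
    by (simp add: is_trig_poly_sum is_trig_poly_monomial)
qed

text \<open>
  Every real linear form on \<open>\<complex>\<close> becomes a combination of \<open>cos t\<close> and \<open>sin t\<close> on the unit circle, hence of
  the exponentials of frequency \<open>1\<close> and \<open>-1\<close>. Since trigonometric polynomials form an algebra, the same
  holds for all real polynomials, which links Fourier series with the Stone-Weierstrass theorem.
\<close>

lemma is_trig_poly_polynomial_cis:
  fixes P :: "complex \<Rightarrow> real"
  assumes "real_polynomial_function P"
  shows "is_trig_poly (\<lambda>t. complex_of_real (P (cis t)))"
  using assms
proof induction
  case (linear f)
  interpret bounded_linear f by fact
  have "complex_of_real (f (cis t)) = (complex_of_real (f 1) - \<i> * complex_of_real (f \<i>)) / 2 * fourier_exp 1 t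
      + (complex_of_real (f 1) + \<i> * complex_of_real (f \<i>)) / 2 * fourier_exp (-1) t" for t
  proof -
    have "cis t = cos t *\<^sub>R 1 + sin t *\<^sub>R \<i>"
      by (simp add: complex_eq_iff)
    then have "f (cis t) = cos t * f 1 + sin t * f \<i>"
      by (simp add: add scaleR)
    moreover have "fourier_exp 1 t = cis t" "fourier_exp (-1) t = cis (- t)"
      by (simp_all add: fourier_exp_def cis_conv_exp)
    ultimately show ?thesis
      by (simp add: complex_eq_iff field_simps)
  qed
  then show ?case
    by (simp only: is_trig_poly_add is_trig_poly_monomial)
next
  case (const c)
  show ?case using is_trig_poly_monomial[of "complex_of_real c" 0] by (simp add: fourier_exp_def)
qed (simp_all add: is_trig_poly_add is_trig_poly_mult)

lemma cnj_fourier_exp: "cnj (fourier_exp n t) = fourier_exp (- n) t"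
  by (simp add: fourier_exp_def exp_cnj)

lemma integral_mult_trig_poly_eq_0:
  assumes f: "f \<in> L2T" and zero: "\<And>n. fourier_coeff f n = 0" and "is_trig_poly p"
  shows "(LINT t|circle_measure. f t * p t) = 0"
proof -
  obtain F a where p: "p = trig_poly F a"
    using assms(3) by (auto simp: is_trig_poly_def)
  have int: "integrable circle_measure (\<lambda>t. f t * fourier_exp n t)" for n
    using integrable_mult_cnj[OF f fourier_exp_in_L2T[of "- n"]] by (simp add: cnj_fourier_exp)
  have "(LINT t|circle_measure. f t * fourier_exp n t) = 0" for n
  proof -
    have "L2T_inner f (fourier_exp (- n)) = 0"
      by (simp only: zero flip: fourier_coeff_eq_inner)
    then show ?thesis
      by (simp add: L2T_inner_def cnj_fourier_exp)
  qed
  moreover have "(LINT t|circle_measure. f t * p t)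
      = (\<Sum>n\<in>F. a n * (LINT t|circle_measure. f t * fourier_exp n t))"
  proof -
    have "(LINT t|circle_measure. f t * p t)
        = (LINT t|circle_measure. (\<Sum>n\<in>F. a n * (f t * fourier_exp n t)))"
      by (simp add: p trig_poly_def sum_distrib_left mult.left_commute)
    also have "\<dots> = (\<Sum>n\<in>F. a n * (LINT t|circle_measure. f t * fourier_exp n t))"
      by (subst Bochner_Integration.integral_sum) (auto intro!: integrable_mult_right int)
    finally show ?thesis .
  qed
  ultimately show ?thesis by simp
qed

text \<open>
  Working on the unit circle rather than on \<open>[0, 2\<pi>]\<close> builds periodicity into the test functions: there
  Stone-Weierstrass approximates \<open>\<phi>\<close> uniformly by polynomials, whose integrals against \<open>f\<close> vanish, and
  the error is at most \<open>\<epsilon>\<close> times the integral of \<open>\<bar>f\<bar>\<close>.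
\<close>

lemma integral_mult_continuous_eq_0:
  fixes \<phi> :: "complex \<Rightarrow> real"
  assumes f: "f \<in> L2T" and zero: "\<And>n. fourier_coeff f n = 0"
    and \<phi>: "continuous_on (sphere 0 1) \<phi>"
  shows "(LINT t|circle_measure. f t * complex_of_real (\<phi> (cis t))) = 0"
proof -
  define C where "C = (LINT t|circle_measure. cmod (f t))"
  have C: "0 \<le> C" unfolding C_def by simp
  have f_int: "integrable circle_measure f" by (rule integrable_L2T[OF f])
  have meas: "(\<lambda>t. complex_of_real (\<psi> (cis t))) \<in> borel_measurable circle_measure"
    if "continuous_on (sphere 0 1) \<psi>" for \<psi> :: "complex \<Rightarrow> real"
    by (intro continuous_imp_measurable_on_sets_lebesgue continuous_intros continuous_on_compose2[OF that]) auto
  have bounded: "\<exists>B. \<forall>t. cmod (complex_of_real (\<psi> (cis t))) \<le> B"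
    if "continuous_on (sphere 0 1) \<psi>" for \<psi> :: "complex \<Rightarrow> real"
  proof -
    have "bounded (\<psi> ` sphere 0 1)"
      using compact_continuous_image[OF that] by (simp add: compact_imp_bounded)
    then show ?thesis by (force simp: bounded_iff)
  qed
  have int: "integrable circle_measure (\<lambda>t. f t * complex_of_real (\<psi> (cis t)))"
    if \<psi>: "continuous_on (sphere 0 1) \<psi>" for \<psi> :: "complex \<Rightarrow> real"
  proof -
    obtain B where B: "\<And>t. cmod (complex_of_real (\<psi> (cis t))) \<le> B"
      using bounded[OF \<psi>] by blast
    show ?thesis
    proof (rule Bochner_Integration.integrable_bound)
      show "integrable circle_measure (\<lambda>t. cmod (f t) * B)"
        using f_int by simp
      show "(\<lambda>t. f t * complex_of_real (\<psi> (cis t))) \<in> borel_measurable circle_measure"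
        using borel_measurable_integrable[OF f_int] meas[OF \<psi>] by (rule borel_measurable_times)
      have "cmod (f t * complex_of_real (\<psi> (cis t))) \<le> cmod (f t) * B" for t
        unfolding norm_mult using B by (intro mult_left_mono) auto
      then show "AE t in circle_measure. norm (f t * complex_of_real (\<psi> (cis t))) \<le> norm (cmod (f t) * B)"
        by (intro AE_I2) (metis norm_ge_zero order_trans real_norm_def abs_of_nonneg)
    qed
  qed
  have "cmod (LINT t|circle_measure. f t * complex_of_real (\<phi> (cis t))) \<le> \<epsilon> * C" if "0 < \<epsilon>" for \<epsilon>
  proof -
    obtain P where P: "real_polynomial_function P" and approx: "\<And>z. z \<in> sphere 0 1 \<Longrightarrow> \<bar>\<phi> z - P z\<bar> < \<epsilon>"
      using Stone_Weierstrass_real_polynomial_function[OF compact_sphere \<phi> \<open>0 < \<epsilon>\<close>] by metis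
    have P_cont: "continuous_on (sphere 0 1) P"
      using P by (intro continuous_on_polymonial_function) (simp add: real_polynomial_function_eq)
    have diff: "continuous_on (sphere 0 1) (\<lambda>z. \<phi> z - P z)"
      by (intro continuous_intros \<phi> P_cont)
    have "(LINT t|circle_measure. f t * complex_of_real (\<phi> (cis t)))
        = (LINT t|circle_measure. f t * complex_of_real (\<phi> (cis t)))
          - (LINT t|circle_measure. f t * complex_of_real (P (cis t)))"
      using integral_mult_trig_poly_eq_0[OF f zero is_trig_poly_polynomial_cis[OF P]] by simp
    also have "\<dots> = (LINT t|circle_measure. f t * complex_of_real (\<phi> (cis t) - P (cis t)))"
      using int[OF \<phi>] int[OF P_cont] by (simp add: right_diff_distrib)
    also have "cmod \<dots> \<le> (LINT t|circle_measure. cmod (f t * complex_of_real (\<phi> (cis t) - P (cis t))))"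
      by (rule integral_norm_bound)
    also have "\<dots> \<le> (LINT t|circle_measure. \<epsilon> * cmod (f t))"
    proof (rule integral_mono)
      show "integrable circle_measure (\<lambda>t. cmod (f t * complex_of_real (\<phi> (cis t) - P (cis t))))"
        using int[OF diff] by (rule integrable_norm)
      show "integrable circle_measure (\<lambda>t. \<epsilon> * cmod (f t))"
        using f_int by simp
      show "cmod (f t * complex_of_real (\<phi> (cis t) - P (cis t))) \<le> \<epsilon> * cmod (f t)" for t
        unfolding norm_mult norm_of_real using approx[of "cis t"]
        by (subst mult.commute) (intro mult_right_mono, auto)
    qed
    also have "\<dots> = \<epsilon> * C" by (simp add: C_def)
    finally show ?thesis .
  qed
  note bound = this
  have "cmod (LINT t|circle_measure. f t * complex_of_real (\<phi> (cis t))) \<le> 0 + e" if "0 < e" for e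
  proof -
    \<comment> \<open>The summand 1 covers the case that the integral C of \<open>\<bar>f\<bar>\<close> is 0.\<close>
    have "e / (C + 1) * C \<le> e" using C that by (simp add: field_simps)
    then show ?thesis using bound[of "e / (C + 1)"] C that by simp
  qed
  then have "cmod (LINT t|circle_measure. f t * complex_of_real (\<phi> (cis t))) \<le> 0"
    by (rule field_le_epsilon)
  then show ?thesis by simp
qed

section \<open>Uniqueness of Fourier coefficients\<close>

text \<open>
  The endpoints \<open>0\<close> and \<open>2\<pi>\<close> are the only two parameters in the closed period that \<open>cis\<close> identifies,
  so it suffices that one of the two parameters is an interior point.
\<close>

lemma cis_inj_interior:
  assumes "cis t = cis s" "0 \<le> t" "t \<le> 2 * pi" "0 < s" "s < 2 * pi"
  shows "t = s"
proof -
  have "cis t / cis s = 1"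
    by (simp add: assms(1))
  then have "cis (t - s) = 1"
    by (simp only: cis_divide)
  then have "cos (t - s) = 1"
    by (simp add: complex_eq_iff)
  then obtain k :: int where k: "t - s = k * 2 * pi"
    by (auto simp: cos_one_2pi_int)
  have "\<bar>t - s\<bar> < 2 * pi" using assms by auto
  then have "\<bar>real_of_int k\<bar> < 1"
    by (simp add: k abs_mult)
  then have "k = 0" by linarith
  then show ?thesis using k by simp
qed

text \<open>
  The indicator of \<open>K\<close> is the pointwise limit of functions that are continuous on the circle, namely of
  the tents that fall off linearly with slope \<open>k\<close> away from the image of \<open>K\<close>. The set \<open>K\<close> avoids the two
  endpoints because they have the same image on the circle.
\<close>

lemma integral_compact_eq_0:
  assumes f: "f \<in> L2T" and zero: "\<And>n. fourier_coeff f n = 0"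
    and K: "compact K" "K \<subseteq> {0<..<2 * pi}"
  shows "(LINT t|circle_measure. f t * indicator K t) = 0"
proof (cases "K = {}")
  case False
  let ?C = "cis ` K"
  define \<phi> where "\<phi> k z = max 0 (1 - real k * infdist z ?C)" for k :: nat and z
  have closed: "closed ?C"
    by (intro compact_imp_closed compact_continuous_image K continuous_intros)
  have cont: "continuous_on (sphere 0 1) (\<phi> k)" for k
    unfolding \<phi>_def by (intro continuous_intros)
  have mem: "cis t \<in> ?C \<longleftrightarrow> t \<in> K" if "t \<in> {0..2 * pi}" for t
    using that K cis_inj_interior[of t] by fastforce
  have lim: "(\<lambda>k. \<phi> k (cis t)) \<longlonglongrightarrow> indicator K t" if t: "t \<in> {0..2 * pi}" for t
  proof (cases "t \<in> K")
    case True
    then show ?thesis by (simp add: \<phi>_def)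
  next
    case notin: False
    then have "0 < infdist (cis t) ?C"
      using mem[OF t] closed False by (simp add: infdist_pos_not_in_closed)
    then have "filterlim (\<lambda>k. real k * infdist (cis t) ?C) at_top sequentially"
      by (intro filterlim_at_top_mult_tendsto_pos[OF tendsto_const] filterlim_real_sequentially)
    then have "\<forall>\<^sub>F k in sequentially. 1 \<le> real k * infdist (cis t) ?C"
      by (simp add: filterlim_at_top)
    then have "\<forall>\<^sub>F k in sequentially. \<phi> k (cis t) = 0"
      by eventually_elim (simp add: \<phi>_def)
    then show ?thesis using notin by (simp add: tendsto_eventually)
  qed
  have meas: "(\<lambda>t. complex_of_real (\<phi> k (cis t))) \<in> borel_measurable circle_measure" for k
    by (intro continuous_imp_measurable_on_sets_lebesgue continuous_intros continuous_on_compose2[OF cont]) auto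
  have "(\<lambda>k. LINT t|circle_measure. f t * complex_of_real (\<phi> k (cis t)))
      \<longlonglongrightarrow> (LINT t|circle_measure. f t * complex_of_real (indicator K t))"
  proof (rule integral_dominated_convergence)
    have "K \<in> sets lebesgue"
      using K(1) by (simp add: compact_imp_closed borel_closed)
    then have "(indicator K :: real \<Rightarrow> real) \<in> borel_measurable circle_measure"
      by (intro measurable_restrict_space1) auto
    then show "(\<lambda>t. f t * complex_of_real (indicator K t)) \<in> borel_measurable circle_measure"
      using L2T_measurable[OF f] by measurable
    show "(\<lambda>t. f t * complex_of_real (\<phi> k (cis t))) \<in> borel_measurable circle_measure" for k
      using L2T_measurable[OF f] meas by measurable
    show "integrable circle_measure (\<lambda>t. cmod (f t))"
      using integrable_L2T[OF f] by simp
    show "AE t in circle_measure. (\<lambda>k. f t * complex_of_real (\<phi> k (cis t)))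
        \<longlonglongrightarrow> f t * complex_of_real (indicator K t)"
      by (intro AE_I2 tendsto_intros lim) simp
    have "\<bar>\<phi> k z\<bar> \<le> 1" for k z
      by (simp add: \<phi>_def infdist_nonneg)
    then show "AE t in circle_measure. cmod (f t * complex_of_real (\<phi> k (cis t))) \<le> cmod (f t)" for k
      by (simp add: norm_mult mult_left_le)
  qed
  then have "(\<lambda>k. 0) \<longlonglongrightarrow> (LINT t|circle_measure. f t * complex_of_real (indicator K t))"
    by (simp only: integral_mult_continuous_eq_0[OF f zero cont])
  then show ?thesis
    by (simp add: tendsto_const_iff of_real_indicator)
qed simp

text \<open>
  Up to a null set, \<open>{Re f > 0}\<close> is a countable union of compact sets \<open>K\<close>. The integral of the positive
  function \<open>Re f\<close> over each \<open>K\<close> vanishes, so each \<open>K\<close> is a null set.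
\<close>

lemma AE_Re_nonpos:
  assumes f: "f \<in> L2T" and zero: "\<And>n. fourier_coeff f n = 0"
  shows "AE t in lebesgue. t \<in> {0<..<2 * pi} \<longrightarrow> Re (f t) \<le> 0"
proof -
  define A where "A = {t. t \<in> {0<..<2 * pi} \<and> 0 < Re (f t)}"
  have [measurable]: "f \<in> borel_measurable lebesgue"
    using f by (simp add: L2T_def)
  have "{t \<in> space lebesgue. 0 < Re (f t)} \<in> sets lebesgue"
    by measurable
  then have "A \<in> sets lebesgue"
    unfolding A_def Collect_conj_eq by (auto intro!: sets.Int)
  then obtain C T where C: "fsigma C" and T: "T \<in> null_sets lebesgue" and A: "C \<union> T = A"
    by (rule lebesgue_set_almost_fsigma)
  obtain F :: "nat \<Rightarrow> real set" where F: "range F \<subseteq> Collect compact" and CF: "C = \<Union>(range F)"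
    using fsigma_Union_compact C by metis
  have "F i \<in> null_sets lebesgue" for i
  proof -
    let ?K = "F i"
    have K: "compact ?K" "?K \<subseteq> A" using F CF A by auto
    then have K01: "?K \<subseteq> {0<..<2 * pi}" by (auto simp: A_def)
    have Kset: "?K \<in> sets lebesgue"
      using K(1) by (simp add: compact_imp_closed borel_closed)
    have ind: "(indicator ?K :: real \<Rightarrow> complex) \<in> borel_measurable circle_measure"
      using Kset by (intro measurable_restrict_space1) auto
    have int: "integrable circle_measure (\<lambda>t. f t * indicator ?K t)"
      using integrable_L2T[OF f] L2T_measurable[OF f] ind
      by (intro Bochner_Integration.integrable_bound[OF integrable_L2T[OF f]])
        (auto intro!: borel_measurable_times split: split_indicator)
    have "(LINT t|circle_measure. Re (f t * indicator ?K t)) = 0"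
      using integral_compact_eq_0[OF f zero K(1) K01] integral_Re[OF int] by simp
    moreover have "AE t in circle_measure. 0 \<le> Re (f t * indicator ?K t)"
      using K(2) by (intro AE_I2) (auto simp: indicator_def A_def)
    ultimately have "AE t in circle_measure. Re (f t * indicator ?K t) = 0"
      using integral_nonneg_eq_0_iff_AE[OF integrable_Re[OF int]] by simp
    then have "AE t in lebesgue. t \<in> {0..2 * pi} \<longrightarrow> Re (f t * indicator ?K t) = 0"
      by (subst (asm) AE_restrict_space_iff) auto
    then have "AE t in lebesgue. t \<notin> ?K"
    proof eventually_elim
      case (elim t)
      then show ?case using K(2) by (auto simp: A_def)
    qed
    then show ?thesis
      using Kset by (simp add: AE_iff_null_sets)
  qed
  then have "A \<in> null_sets lebesgue"
    using T A CF by auto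
  then show ?thesis
    by (rule AE_I') (auto simp: A_def)
qed

lemma fourier_coeff_cmult: "fourier_coeff (\<lambda>t. c * f t) n = c * fourier_coeff f n"
  by (simp add: fourier_coeff_def mult.assoc)

text \<open>
  The exceptional set is covered by the countably many translates of its part in one period. The period
  may be taken open since the endpoint adds only the single point \<open>0\<close>.
\<close>

lemma AE_periodic:
  assumes per: "\<And>t. P (t + 2 * pi) \<longleftrightarrow> P t"
    and AE: "AE t in lebesgue. t \<in> {0<..<2 * pi} \<longrightarrow> P t"
  shows "AE t in lebesgue. P t"
proof -
  have shift: "P (t + 2 * pi * of_int k) \<longleftrightarrow> P t" for t and k :: int
  proof (induction k rule: int_induct[where k=0])
    case (step1 i)
    then show ?case using per[of "t + 2 * pi * of_int i"] by (simp add: algebra_simps)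
  next
    case (step2 i)
    then show ?case using per[of "t + 2 * pi * of_int (i - 1)"] by (simp add: algebra_simps)
  qed simp
  define N where "N = {t. \<not> (t \<in> {0<..<2 * pi} \<longrightarrow> P t)} \<union> {0}"
  have "negligible N"
  proof -
    obtain Z where Z: "Z \<in> null_sets lebesgue" "{t. \<not> (t \<in> {0<..<2 * pi} \<longrightarrow> P t)} \<subseteq> Z"
      using AE by (auto simp: eventually_ae_filter)
    then have "negligible (insert 0 Z)"
      by (simp add: negligible_iff_null_sets[symmetric])
    then show ?thesis
      by (rule negligible_subset) (use Z in \<open>auto simp: N_def\<close>)
  qed
  then have "negligible (\<Union>k::int. (+) (2 * pi * of_int k) ` N)"
    by (intro negligible_countable_Union) (auto intro: negligible_translation)
  moreover have "{t. \<not> P t} \<subseteq> (\<Union>k::int. (+) (2 * pi * of_int k) ` N)"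
  proof
    fix t assume t: "t \<in> {t. \<not> P t}"
    define k where "k = \<lfloor>t / (2 * pi)\<rfloor>"
    define s where "s = t - 2 * pi * of_int k"
    have "of_int k \<le> t / (2 * pi)" "t / (2 * pi) < of_int k + 1"
      unfolding k_def by linarith+
    then have "0 \<le> s" "s < 2 * pi"
      by (simp_all add: s_def field_simps)
    moreover have "\<not> P s"
      using t shift[of s k] by (simp add: s_def)
    ultimately have "s \<in> N" by (auto simp: N_def)
    then show "t \<in> (\<Union>k::int. (+) (2 * pi * of_int k) ` N)"
      by (intro UN_I[of k]) (auto simp: s_def intro!: image_eqI[of _ _ s])
  qed
  ultimately have "{t. \<not> P t} \<in> null_sets lebesgue"
    using negligible_subset negligible_iff_null_sets by blast
  then show ?thesis
    by (rule AE_I') auto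
qed

text \<open>
  Applying the one-sided bound to \<open>f\<close>, \<open>-f\<close>, \<open>\<i>f\<close> and \<open>-\<i>f\<close> removes both the real and the imaginary
  part.
\<close>

lemma AE_eq_0_of_fourier_coeff_eq_0:
  assumes f: "f \<in> L2T" and zero: "\<And>n. fourier_coeff f n = 0"
  shows "AE t in lebesgue. f t = 0"
proof (rule AE_periodic)
  show "f (t + 2 * pi) = 0 \<longleftrightarrow> f t = 0" for t
    by (simp add: L2T_periodic[OF f])
  have rot: "AE t in lebesgue. t \<in> {0<..<2 * pi} \<longrightarrow> Re (c * f t) \<le> 0" for c
    by (intro AE_Re_nonpos L2T_cmult f) (simp add: fourier_coeff_cmult zero)
  show "AE t in lebesgue. t \<in> {0<..<2 * pi} \<longrightarrow> f t = 0"
    using rot[of 1] rot[of "-1"] rot[of \<i>] rot[of "- \<i>"]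
    by eventually_elim (auto simp: complex_eq_iff)
qed

section \<open>The Riesz-Fischer theorem\<close>

text \<open>
  Fatou's lemma in the form needed to pass from almost everywhere convergence to membership in
  \<open>L\<^sup>2(\<T>)\<close> together with a norm bound. Periodicity of \<open>h\<close> is a hypothesis because
  it does not follow from convergence almost everywhere.
\<close>

lemma L2T_fatou:
  assumes u: "\<And>k. u k \<in> L2T" and h: "h \<in> borel_measurable lebesgue" "\<And>t. h (t + 2 * pi) = h t"
    and lim: "AE t in circle_measure. (\<lambda>k. u k t) \<longlonglongrightarrow> h t"
    and bound: "\<forall>\<^sub>F k in sequentially. (L2T_norm (u k))\<^sup>2 \<le> B"
  shows "h \<in> L2T" "(L2T_norm h)\<^sup>2 \<le> B"
proof -
  have hm: "h \<in> borel_measurable circle_measure"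
    using h(1) by (rule measurable_restrict_space1)
  have "(\<integral>\<^sup>+ t. ennreal ((cmod (h t))\<^sup>2) \<partial>circle_measure)
      = (\<integral>\<^sup>+ t. liminf (\<lambda>k. ennreal ((cmod (u k t))\<^sup>2)) \<partial>circle_measure)"
  proof (rule nn_integral_cong_AE)
    show "AE t in circle_measure. ennreal ((cmod (h t))\<^sup>2) = liminf (\<lambda>k. ennreal ((cmod (u k t))\<^sup>2))"
      using lim
    proof eventually_elim
      case (elim t)
      then have "(\<lambda>k. ennreal ((cmod (u k t))\<^sup>2)) \<longlonglongrightarrow> ennreal ((cmod (h t))\<^sup>2)"
        by (intro tendsto_intros)
      then show ?case
        by (simp only: lim_imp_Liminf trivial_limit_sequentially not_False_eq_True)
    qed
  qed
  also have "\<dots> \<le> liminf (\<lambda>k. \<integral>\<^sup>+ t. ennreal ((cmod (u k t))\<^sup>2) \<partial>circle_measure)"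
    using L2T_measurable[OF u] by (intro nn_integral_liminf) measurable
  also have "\<dots> \<le> liminf (\<lambda>k. ennreal (2 * pi * B))"
  proof (rule Liminf_mono)
    show "\<forall>\<^sub>F k in sequentially.
        (\<integral>\<^sup>+ t. ennreal ((cmod (u k t))\<^sup>2) \<partial>circle_measure) \<le> ennreal (2 * pi * B)"
      using bound
    proof eventually_elim
      case (elim k)
      have "(\<integral>\<^sup>+ t. ennreal ((cmod (u k t))\<^sup>2) \<partial>circle_measure)
          = ennreal (LINT t|circle_measure. (cmod (u k t))\<^sup>2)"
        using L2T_square_integrable[OF u] by (intro nn_integral_eq_integral) auto
      also have "(LINT t|circle_measure. (cmod (u k t))\<^sup>2) = 2 * pi * (L2T_norm (u k))\<^sup>2"
        by (simp add: L2T_norm_square)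
      finally show ?case
        using elim by (simp add: ennreal_leI)
    qed
  qed
  also have "\<dots> = ennreal (2 * pi * B)"
    by (simp add: Liminf_const)
  finally have le: "(\<integral>\<^sup>+ t. ennreal ((cmod (h t))\<^sup>2) \<partial>circle_measure) \<le> ennreal (2 * pi * B)" .
  have int: "integrable circle_measure (\<lambda>t. (cmod (h t))\<^sup>2)"
  proof (rule integrableI_bounded)
    show "(\<lambda>t. (cmod (h t))\<^sup>2) \<in> borel_measurable circle_measure"
      using hm by measurable
    show "(\<integral>\<^sup>+ t. ennreal (norm ((cmod (h t))\<^sup>2)) \<partial>circle_measure) < \<infinity>"
      using le by (simp add: le_less_trans)
  qed
  then show "h \<in> L2T"
    using h by (simp add: L2T_def)
  obtain k where "(L2T_norm (u k))\<^sup>2 \<le> B"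
    using eventually_happens[OF bound] by auto
  then have "0 \<le> B"
    using zero_le_power2[of "L2T_norm (u k)"] by linarith
  moreover have "ennreal (LINT t|circle_measure. (cmod (h t))\<^sup>2) \<le> ennreal (2 * pi * B)"
    using le by (subst (asm) nn_integral_eq_integral[OF int]) auto
  ultimately have "(LINT t|circle_measure. (cmod (h t))\<^sup>2) \<le> 2 * pi * B"
    by (simp add: ennreal_le_iff)
  then show "(L2T_norm h)\<^sup>2 \<le> B"
    by (simp add: L2T_norm_square field_simps)
qed

text \<open>
  Integrating the pointwise bound \<open>\<bar>f\<bar> \<le> r/2 + \<bar>f\<bar>\<^sup>2/(2r)\<close>, an instance of the inequality between
  arithmetic and geometric mean, bounds the \<open>L\<^sup>1\<close> norm by the \<open>L\<^sup>2\<close> norm.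
\<close>

lemma integral_norm_le_of_L2T_norm_le:
  assumes f: "f \<in> L2T" and "L2T_norm f \<le> r" "0 < r"
  shows "(LINT t|circle_measure. cmod (f t)) \<le> 2 * pi * r"
proof -
  interpret finite_measure circle_measure by (rule finite_circle_measure)
  have amgm: "cmod (f t) \<le> r / 2 + (cmod (f t))\<^sup>2 / (2 * r)" for t
    using zero_le_power2[of "cmod (f t) - r"] \<open>0 < r\<close> by (simp add: field_simps power2_eq_square)
  have "(LINT t|circle_measure. cmod (f t)) \<le> (LINT t|circle_measure. r / 2 + (cmod (f t))\<^sup>2 / (2 * r))"
    using f amgm by (intro integral_mono integrable_norm integrable_L2T Bochner_Integration.integrable_add
        integrable_const integrable_divide L2T_square_integrable)
  also have "\<dots> = pi * r + (LINT t|circle_measure. (cmod (f t))\<^sup>2) / (2 * r)"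
    using L2T_square_integrable[OF f] by (simp add: measure_restrict_space)
  also have "(LINT t|circle_measure. (cmod (f t))\<^sup>2) = 2 * pi * (L2T_norm f)\<^sup>2"
    by (simp add: L2T_norm_square)
  also have "pi * r + 2 * pi * (L2T_norm f)\<^sup>2 / (2 * r) \<le> pi * r + 2 * pi * r\<^sup>2 / (2 * r)"
    using assms L2T_norm_nonneg[of f] by (intro add_left_mono divide_right_mono mult_left_mono power_mono) auto
  also have "\<dots> = 2 * pi * r"
    using \<open>0 < r\<close> by (simp add: power2_eq_square)
  finally show ?thesis .
qed

text \<open>
  The norms of the increments dominate their \<open>L\<^sup>1\<close> norms, so the sum of the absolute increments has a
  finite integral and is therefore finite almost everywhere; at such points the sequence telescopes
  along an absolutely convergent series.
\<close>

lemma AE_convergent_of_geometric_increments: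
  assumes S: "\<And>k. S k \<in> L2T"
    and step: "\<And>k. L2T_norm (\<lambda>t. S (Suc k) t - S k t) \<le> (1 / 2) ^ k"
  shows "AE t in circle_measure. convergent (\<lambda>k. S k t)"
proof -
  let ?d = "\<lambda>k t. S (Suc k) t - S k t"
  have d: "?d k \<in> L2T" for k by (intro L2T_diff S)
  have d_meas: "(\<lambda>t. ennreal (cmod (?d k t))) \<in> borel_measurable circle_measure" for k
    using L2T_measurable[OF S] by measurable
  have "(\<integral>\<^sup>+ t. (\<Sum>k. ennreal (cmod (?d k t))) \<partial>circle_measure)
      = (\<Sum>k. \<integral>\<^sup>+ t. ennreal (cmod (?d k t)) \<partial>circle_measure)"
    using d_meas by (intro nn_integral_suminf)
  also have "\<dots> \<le> (\<Sum>k. ennreal (2 * pi * (1 / 2) ^ k))"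
  proof (intro suminf_le summableI)
    fix k
    have "(\<integral>\<^sup>+ t. ennreal (cmod (?d k t)) \<partial>circle_measure) = ennreal (LINT t|circle_measure. cmod (?d k t))"
      using integrable_L2T[OF d] by (intro nn_integral_eq_integral) auto
    also have "\<dots> \<le> ennreal (2 * pi * (1 / 2) ^ k)"
      using integral_norm_le_of_L2T_norm_le[OF d step] by (intro ennreal_leI) simp
    finally show "(\<integral>\<^sup>+ t. ennreal (cmod (?d k t)) \<partial>circle_measure) \<le> ennreal (2 * pi * (1 / 2) ^ k)" .
  qed
  also have "\<dots> = ennreal (\<Sum>k. 2 * pi * (1 / 2) ^ k)"
    by (intro suminf_ennreal2 summable_mult summable_geometric) auto
  also have "\<dots> < \<infinity>" by simp
  finally have "AE t in circle_measure. (\<Sum>k. ennreal (cmod (?d k t))) \<noteq> \<infinity>"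
    using d_meas by (intro nn_integral_PInf_AE borel_measurable_suminf_order) auto
  then show ?thesis
  proof eventually_elim
    case (elim t)
    then have "summable (\<lambda>k. cmod (?d k t))"
      by (intro summable_suminf_not_top) auto
    then have "summable (\<lambda>k. ?d k t)"
      by (rule summable_norm_cancel)
    then have "convergent (\<lambda>n. \<Sum>k<n. ?d k t)"
      by (simp add: summable_iff_convergent)
    then have "convergent (\<lambda>n. S n t - S 0 t)"
      by (simp only: sum_lessThan_telescope[of "\<lambda>k. S k t"])
    then show ?case
      by (simp add: convergent_diff_const_right_iff)
  qed
qed

lemma trig_poly_diff:
  assumes "finite G" "F \<subseteq> G"
  shows "trig_poly G a t - trig_poly F a t = trig_poly (G - F) a t"
  using sum.subset_diff[OF assms(2,1), of "\<lambda>n. a n * fourier_exp n t"] by (simp add: trig_poly_def)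

text \<open>
  Partial sums over a chain of finite sets whose tails decay like \<open>4\<^sup>-\<^sup>k\<close> have increments of norm at most
  \<open>2\<^sup>-\<^sup>k\<close>, hence converge almost everywhere. Their pointwise limit \<open>g\<close> is the sum: Fatou's lemma bounds
  \<open>\<parallel>g - p\<parallel>\<^sup>2\<close>, for the partial sum \<open>p\<close> over any finite \<open>F\<close>, by the tail \<open>s - q F\<close> of the squared
  coefficients, and this tail tends to \<open>0\<close> along the net of all finite sets. Unconditional
  convergence is therefore obtained at once, not only convergence along the chain.
\<close>

theorem riesz_fischer:
  assumes c: "c \<in> l2Z"
  shows "\<exists>g. L2T_has_sum (\<lambda>n t. c n * fourier_exp n t) g"
proof -
  define q where "q F = (\<Sum>n\<in>F. (cmod (c n))\<^sup>2)" for F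
  define s where "s = infsum (\<lambda>n. (cmod (c n))\<^sup>2) UNIV"
  have "((\<lambda>n. (cmod (c n))\<^sup>2) has_sum s) UNIV"
    using c by (simp add: l2Z_def s_def)
  then have q_lim: "(q \<longlongrightarrow> s) (finite_subsets_at_top UNIV)"
    by (simp add: has_sum_def q_def[abs_def])
  have q_le: "q F \<le> s" if "finite F" for F
    unfolding q_def s_def using c that by (intro finite_sum_le_infsum) (auto simp: l2Z_def)
  have increment: "(L2T_norm (\<lambda>t. trig_poly G c t - trig_poly F c t))\<^sup>2 \<le> s - q F"
    if "finite G" "F \<subseteq> G" for F G
  proof -
    have "(L2T_norm (\<lambda>t. trig_poly G c t - trig_poly F c t))\<^sup>2 = q (G - F)"
      using that by (simp add: trig_poly_diff L2T_norm_trig_poly q_def)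
    also have "\<dots> = q G - q F"
      using that by (simp add: q_def sum_diff)
    finally show ?thesis using q_le[OF \<open>finite G\<close>] by simp
  qed
  have "\<exists>X. finite X \<and> (\<forall>F. finite F \<and> X \<subseteq> F \<longrightarrow> s - q F \<le> (1 / 4) ^ k)" for k :: nat
  proof -
    have "\<forall>\<^sub>F F in finite_subsets_at_top UNIV. dist (q F) s < (1 / 4) ^ k"
      using q_lim by (rule tendstoD) simp
    then obtain X where "finite X" "\<And>F. finite F \<Longrightarrow> X \<subseteq> F \<Longrightarrow> dist (q F) s < (1 / 4) ^ k"
      by (auto simp: eventually_finite_subsets_at_top)
    then have "\<And>F. finite F \<Longrightarrow> X \<subseteq> F \<Longrightarrow> s - q F \<le> (1 / 4) ^ k"
      by (fastforce simp: dist_real_def)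
    with \<open>finite X\<close> show ?thesis by blast
  qed
  then obtain B where B: "\<And>k. finite (B k)"
    "\<And>k F. finite F \<Longrightarrow> B k \<subseteq> F \<Longrightarrow> s - q F \<le> (1 / 4) ^ k" for k :: nat
    by metis
  \<comment> \<open>The unions make the chain increasing, and the intervals make it exhaust the integers, so that every
    finite index set is eventually contained in it.\<close>
  define A where "A k = (\<Union>i\<le>k. B i \<union> {- int i..int i})" for k
  have A_fin: "finite (A k)" for k
    using B(1) by (simp add: A_def)
  have A_mono: "A k \<subseteq> A l" if "k \<le> l" for k l
    unfolding A_def using that by (intro UN_mono) auto
  have A_exhaust: "\<forall>\<^sub>F k in sequentially. F \<subseteq> A k" if "finite F" for F
  proof -
    define m where "m = (\<Sum>n\<in>F. nat \<bar>n\<bar>)"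
    have m: "nat \<bar>n\<bar> \<le> m" if "n \<in> F" for n
      unfolding m_def by (rule member_le_sum[of n F "\<lambda>n. nat \<bar>n\<bar>"]) (use that \<open>finite F\<close> in auto)
    have "F \<subseteq> A m"
    proof
      fix n assume "n \<in> F"
      then have "n \<in> {- int m..int m}" using m[of n] by auto
      then show "n \<in> A m" by (auto simp: A_def)
    qed
    then show ?thesis
      using A_mono by (intro eventually_sequentiallyI[of m]) blast
  qed
  define S where "S k = trig_poly (A k) c" for k
  have S: "S k \<in> L2T" for k by (simp add: S_def trig_poly_in_L2T)
  have step: "L2T_norm (\<lambda>t. S (Suc k) t - S k t) \<le> (1 / 2) ^ k" for k
  proof -
    have "(L2T_norm (\<lambda>t. S (Suc k) t - S k t))\<^sup>2 \<le> s - q (A k)"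
      unfolding S_def by (intro increment A_fin A_mono) simp
    also have "\<dots> \<le> (1 / 4) ^ k"
      by (rule B(2)[OF A_fin]) (auto simp: A_def)
    also have "(1 / 4 :: real) ^ k = ((1 / 2) ^ k)\<^sup>2"
      by (simp add: power2_eq_square flip: power_mult_distrib)
    finally show ?thesis
      by (rule power2_le_imp_le) simp
  qed
  \<comment> \<open>Taking lim at every point, also where the sequence diverges, keeps g periodic everywhere:
    the sequences at t and at \<open>t + 2 * pi\<close> coincide.\<close>
  define g where "g t = lim (\<lambda>k. S k t)" for t
  have lim: "AE t in circle_measure. (\<lambda>k. S k t) \<longlonglongrightarrow> g t"
    using AE_convergent_of_geometric_increments[OF S step]
    by eventually_elim (simp add: g_def convergent_LIMSEQ_iff)
  have g_meas: "g \<in> borel_measurable lebesgue"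
    unfolding g_def[abs_def] using S by (intro borel_measurable_lim_metric) (simp add: L2T_def)
  have g_per: "g (t + 2 * pi) = g t" for t
    by (simp add: g_def L2T_periodic[OF S])
  have g: "(\<lambda>t. g t - trig_poly F c t) \<in> L2T" "(L2T_norm (\<lambda>t. g t - trig_poly F c t))\<^sup>2 \<le> s - q F"
    if F: "finite F" for F
  proof -
    let ?u = "\<lambda>k t. S k t - trig_poly F c t" and ?h = "\<lambda>t. g t - trig_poly F c t"
    note T = trig_poly_in_L2T[of F c]
    have u: "?u k \<in> L2T" for k by (intro L2T_diff S T)
    have h: "?h \<in> borel_measurable lebesgue"
      using g_meas T by (intro borel_measurable_diff) (simp_all add: L2T_def)
    have per: "?h (t + 2 * pi) = ?h t" for t
      by (simp add: g_per L2T_periodic[OF T])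
    have ulim: "AE t in circle_measure. (\<lambda>k. ?u k t) \<longlonglongrightarrow> ?h t"
      using lim by eventually_elim (intro tendsto_intros)
    have bound: "\<forall>\<^sub>F k in sequentially. (L2T_norm (?u k))\<^sup>2 \<le> s - q F"
      using A_exhaust[OF F] by eventually_elim (simp add: S_def increment A_fin)
    show "?h \<in> L2T" "(L2T_norm ?h)\<^sup>2 \<le> s - q F"
      using L2T_fatou[OF u h per ulim bound] by auto
  qed
  have "g \<in> L2T"
    using g(1)[of "{}"] by (simp add: trig_poly_def)
  moreover have "((\<lambda>F. L2T_norm (\<lambda>t. trig_poly F c t - g t)) \<longlongrightarrow> 0) (finite_subsets_at_top UNIV)"
  proof (rule tendsto_sandwich[OF _ _ tendsto_const])
    show "\<forall>\<^sub>F F in finite_subsets_at_top UNIV. 0 \<le> L2T_norm (\<lambda>t. trig_poly F c t - g t)"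
      by (simp add: L2T_norm_nonneg)
    show "\<forall>\<^sub>F F in finite_subsets_at_top UNIV. L2T_norm (\<lambda>t. trig_poly F c t - g t) \<le> sqrt (s - q F)"
      unfolding eventually_finite_subsets_at_top
      by (intro exI[of _ "{}"] conjI allI impI, simp, simp)
        (subst L2T_norm_minus_commute, intro real_le_rsqrt g(2), simp)
    have "((\<lambda>F. sqrt (s - q F)) \<longlongrightarrow> sqrt (s - s)) (finite_subsets_at_top UNIV)"
      by (intro tendsto_intros q_lim)
    then show "((\<lambda>F. sqrt (s - q F)) \<longlongrightarrow> 0) (finite_subsets_at_top UNIV)"
      by simp
  qed
  ultimately show ?thesis
    by (auto simp: L2T_has_sum_iff)
qed

section \<open>Fourier analysis and synthesis\<close>

lemma AE_eq_of_fourier_coeff_eq: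
  assumes "f \<in> L2T" "g \<in> L2T" "fourier_coeff f = fourier_coeff g"
  shows "AE t in lebesgue. f t = g t"
  using AE_eq_0_of_fourier_coeff_eq_0[OF L2T_diff[OF assms(1,2)]] assms
  by (simp add: fourier_coeff_diff)

lemma fourier_synthesis_has_sum:
  assumes "c \<in> l2Z"
  shows "L2T_has_sum (\<lambda>n t. c n * fourier_exp n t) (fourier_synthesis c)"
  unfolding fourier_synthesis_def using riesz_fischer[OF assms] by (rule someI_ex)

lemma fourier_coeff_synthesis:
  assumes "c \<in> l2Z" shows "fourier_coeff (fourier_synthesis c) = c"
  using fourier_coeff_of_has_sum[OF fourier_synthesis_has_sum[OF assms]] by (simp add: fun_eq_iff)

lemma fourier_synthesis_in_L2T: "c \<in> l2Z \<Longrightarrow> fourier_synthesis c \<in> L2T"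
  using fourier_synthesis_has_sum by (simp add: L2T_has_sum_iff)

lemma fourier_synthesis_fourier_coeff:
  assumes "f \<in> L2T" shows "AE t in lebesgue. fourier_synthesis (fourier_coeff f) t = f t"
  using assms by (intro AE_eq_of_fourier_coeff_eq)
    (simp_all add: fourier_coeff_in_l2Z fourier_synthesis_in_L2T fourier_coeff_synthesis)

text \<open>
  The Riesz-Fischer theorem provides some sum of the Fourier series of \<open>f\<close>; it has the Fourier
  coefficients of \<open>f\<close>, so it equals \<open>f\<close> almost everywhere, which the norm cannot distinguish.
\<close>

lemma fourier_series_has_sum:
  assumes f: "f \<in> L2T"
  shows "L2T_has_sum (\<lambda>n t. fourier_coeff f n * fourier_exp n t) f"
proof -
  let ?g = "fourier_synthesis (fourier_coeff f)"
  note c = fourier_coeff_in_l2Z[OF f]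
  have AE: "AE t in circle_measure. ?g t = f t"
    using fourier_synthesis_fourier_coeff[OF f]
    by (subst AE_restrict_space_iff) (auto elim: eventually_mono)
  have g: "?g \<in> L2T" by (rule fourier_synthesis_in_L2T[OF c])
  have "L2T_norm (\<lambda>t. trig_poly F (fourier_coeff f) t - ?g t)
      = L2T_norm (\<lambda>t. trig_poly F (fourier_coeff f) t - f t)" for F
    by (rule L2T_norm_cong_AE) (use AE f g in \<open>auto intro!: L2T_diff trig_poly_in_L2T\<close>)
  then show ?thesis
    using fourier_synthesis_has_sum[OF c] f by (simp add: L2T_has_sum_iff)
qed

lemma fourier_exp_orthonormal_basis: "L2T_orthonormal_basis fourier_exp"
  unfolding L2T_orthonormal_basis_def
proof (intro conjI allI ballI impI)
  fix f :: "real \<Rightarrow> complex" and \<epsilon> :: real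
  assume "f \<in> L2T" and "0 < \<epsilon>"
  then have "\<forall>\<^sub>F F in finite_subsets_at_top UNIV.
      dist (L2T_norm (\<lambda>t. trig_poly F (fourier_coeff f) t - f t)) 0 < \<epsilon>"
    using fourier_series_has_sum[of f] by (intro tendstoD) (simp_all add: L2T_has_sum_iff)
  then obtain F where "finite F" "L2T_norm (\<lambda>t. trig_poly F (fourier_coeff f) t - f t) < \<epsilon>"
    by (force simp: eventually_finite_subsets_at_top L2T_norm_nonneg)
  then have "finite F" "L2T_norm (\<lambda>t. f t - trig_poly F (fourier_coeff f) t) < \<epsilon>"
    by (simp_all only: L2T_norm_minus_commute[of f])
  then show "\<exists>F a. finite F \<and> L2T_norm (\<lambda>t. f t - (\<Sum>n\<in>F. a n * fourier_exp n t)) < \<epsilon>"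
    unfolding trig_poly_def by blast
qed (rule fourier_exp_in_L2T fourier_exp_orthonormal)+

theorem theorem5p4:
  shows "(\<forall>f\<in>L2T. fourier_coeff f \<in> l2Z \<and>
            L2T_has_sum (\<lambda>n t. fourier_coeff f n * fourier_exp n t) f \<and>
            (AE t in lebesgue. fourier_synthesis (fourier_coeff f) t = f t)) \<and>
         (\<forall>c\<in>l2Z. L2T_has_sum (\<lambda>n t. c n * fourier_exp n t) (fourier_synthesis c) \<and>
            (\<forall>g. L2T_has_sum (\<lambda>n t. c n * fourier_exp n t) g \<longrightarrow> (\<forall>j. fourier_coeff g j = c j)) \<and>
            fourier_coeff (fourier_synthesis c) = c) \<and>
         L2T_orthonormal_basis fourier_exp"
  by (intro conjI ballI allI impI fourier_coeff_in_l2Z fourier_series_has_sum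
      fourier_synthesis_fourier_coeff fourier_synthesis_has_sum fourier_coeff_synthesis
      fourier_exp_orthonormal_basis) (assumption | rule fourier_coeff_of_has_sum)+

end
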